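(* If $L$ is a latin square of order $n$, then $$\beta(G(L)) \geq n-\sqrt{\frac{n}{3}+\frac{37}{36}}+ \frac{1}{6}.$$
   Context: Here $n$ is a positive integer. A latin square $L$ of order $n$ is an $n\times n$ array with entries from a set of $n$ symbols such that each symbol occurs exactly once in each row and in each column. The latin square graph $G(L)$ is the graph whose $n^2$ vertices are the cells of $L$, where two distinct cells are adjacent if they share a row, share a column, or contain the same symbol. The metric dimension $\beta(G)$ of a connected graph $G$ is the minimum number $m$ of vertices $u_1,\dots,u_m$ of $G$ such that every vertex $v$ of $G$ is uniquely determined by its vector of graph distances $(d(u_1,v),\dots,d(u_m,v))$. *)

theory Defs
  imports Complex_Main "Graph_Theory.Graph_Theory"
begin

section \<open>Latin squares\<close>

definition latin_square :: "nat \<Rightarrow> 's set \<Rightarrow> (nat \<Rightarrow> nat \<Rightarrow> 's) \<Rightarrow> bool" where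
  "latin_square n S L \<longleftrightarrow>
     finite S \<and> card S = n \<and>
     (\<forall>i<n. \<forall>j<n. L i j \<in> S) \<and>
     (\<forall>i<n. \<forall>s\<in>S. \<exists>!j. j < n \<and> L i j = s) \<and>
     (\<forall>j<n. \<forall>s\<in>S. \<exists>!i. i < n \<and> L i j = s)"

text \<open>Rows and columns are numbered from \<open>0\<close> to \<open>n - 1\<close>. As usual in \<open>Graph_Theory\<close>, an
  undirected graph is a symmetric digraph: an edge is represented by its two orientations.\<close>

definition latin_square_graph :: "nat \<Rightarrow> (nat \<Rightarrow> nat \<Rightarrow> 's) \<Rightarrow> (nat \<times> nat) pair_pre_digraph" where
  "latin_square_graph n L =
     \<lparr> pverts = {..<n} \<times> {..<n},
       parcs = {((i, j), (k, l)) | i j k l.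
                  i < n \<and> j < n \<and> k < n \<and> l < n \<and> (i, j) \<noteq> (k, l) \<and>
                  (i = k \<or> j = l \<or> L i j = L k l)} \<rparr>"

section \<open>Metric dimension\<close>

text \<open>Distance is the infimum of the costs of walks when every arc has weight \<open>1\<close>;
  see \<open>graph_dist_eq_length\<close> below.\<close>

definition graph_dist :: "('a, 'b) pre_digraph \<Rightarrow> 'a \<Rightarrow> 'a \<Rightarrow> ereal" where
  "graph_dist G u v = wf_digraph.\<mu> G (\<lambda>_. 1) u v"

definition resolving :: "('a, 'b) pre_digraph \<Rightarrow> 'a list \<Rightarrow> bool" where
  "resolving G us \<longleftrightarrow> set us \<subseteq> verts G \<and>
     (\<forall>v\<in>verts G. \<forall>w\<in>verts G.
        map (\<lambda>u. graph_dist G u v) us = map (\<lambda>u. graph_dist G u w) us \<longrightarrow> v = w)"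

definition metric_dimension :: "('a, 'b) pre_digraph \<Rightarrow> nat" where
  "metric_dimension G = (LEAST m. \<exists>us. length us = m \<and> resolving G us)"

section \<open>Sanity checks\<close>

lemma (in wf_digraph) graph_dist_eq_length:
  "graph_dist G u v = (INF p\<in>{p. awalk u p v}. ereal (real (length p)))"
proof -
  have "awalk_cost (\<lambda>_. 1) p = real (length p)" for p :: "'b list"
    by (induct p) auto
  then show ?thesis by (simp add: graph_dist_def \<mu>_def)
qed

lemma pair_graph_latin_square_graph: "pair_graph (latin_square_graph n L)"
proof -
  have sub: "parcs (latin_square_graph n L) \<subseteq> ({..<n} \<times> {..<n}) \<times> ({..<n} \<times> {..<n})"
    by (auto simp: latin_square_graph_def)
  have fin: "finite (parcs (latin_square_graph n L))"
    by (rule finite_subset[OF sub]) simp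
  show ?thesis
    by unfold_locales
      (use sub fin in \<open>auto simp: latin_square_graph_def symmetric_def sym_def\<close>)
qed

lemma connected_latin_square_graph:
  assumes "n > 0"
  shows "connected (latin_square_graph n L)"
proof -
  let ?G = "latin_square_graph n L"
  interpret pair_graph ?G by (rule pair_graph_latin_square_graph)
  have step: "(i, j) \<rightarrow>\<^sup>*\<^bsub>?G\<^esub> (k, l)"
    if "i < n" "j < n" "k < n" "l < n" "i = k \<or> j = l" for i j k l
  proof (cases "(i, j) = (k, l)")
    case True
    moreover have "(k, l) \<in> pverts ?G" using that by (simp add: latin_square_graph_def)
    ultimately show ?thesis by (simp add: reachable_refl)
  next
    case False
    then have "((i, j), (k, l)) \<in> parcs ?G" using that by (auto simp: latin_square_graph_def)
    then show ?thesis by (simp add: reachable_adjI)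
  qed
  have reach: "u \<rightarrow>\<^sup>*\<^bsub>?G\<^esub> v" if "u \<in> pverts ?G" "v \<in> pverts ?G" for u v
  proof -
    obtain i j k l where "u = (i, j)" "v = (k, l)" by (metis surj_pair)
    moreover have "i < n" "j < n" "k < n" "l < n"
      using that calculation by (auto simp: latin_square_graph_def)
    ultimately show ?thesis using step[of i j i l] step[of i l k l] reachable_trans by blast
  qed
  have "pverts ?G \<noteq> {}" using assms by (auto simp: latin_square_graph_def)
  moreover have "(u, v) \<in> rtrancl_on (pverts ?G) ((parcs ?G)\<^sup>s)"
    if "u \<in> pverts ?G" "v \<in> pverts ?G" for u v
  proof (rule rtrancl_on_mono)
    show "(u, v) \<in> rtrancl_on (pverts ?G) (parcs ?G)"
      using reach[OF that] by (simp add: reachable_def)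
  qed (auto simp: symcl_def)
  ultimately show ?thesis by (simp add: connected_conv)
qed

lemma (in fin_digraph) resolving_exists: "\<exists>us. resolving G us"
proof -
  obtain us where us: "set us = verts G" using finite_list finite_verts by blast
  have "v = w" if "v \<in> verts G" "graph_dist G v v = graph_dist G v w" for v w
  proof (rule ccontr)
    assume neq: "v \<noteq> w"
    have "graph_dist G v v \<le> ereal (real (length ([] :: 'b list)))"
      unfolding graph_dist_eq_length
      by (rule INF_lower) (use that(1) in \<open>simp add: awalk_Nil_iff\<close>)
    moreover have "1 \<le> graph_dist G v w"
      unfolding graph_dist_eq_length
    proof (rule INF_greatest)
      fix p assume "p \<in> {p. awalk v p w}"
      with neq have "p \<noteq> []" by (auto simp: awalk_Nil_iff)
      then show "1 \<le> ereal (real (length p))" by (cases p) auto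
    qed
    ultimately have "(1::ereal) \<le> ereal 0" using that(2) by (metis list.size(3) of_nat_0 order_trans)
    then show False by simp
  qed
  then have "resolving G us" unfolding resolving_def us by (simp add: us)
  then show ?thesis ..
qed

end

theory Submission
  imports Defs
begin

text \<open>
  Let \<open>P\<close> be a resolving set with \<open>p = n - d\<close> cells, \<open>d > 0\<close>, and let \<open>a, b, c \<ge> d\<close> be the numbers
  of rows, columns and symbols that \<open>P\<close> misses. Since all distances between distinct cells are
  \<open>1\<close> or \<open>2\<close>, cells outside \<open>P\<close> have different neighbourhoods in \<open>P\<close>. At most one cell has an
  empty neighbourhood. A cell that is missed in exactly two of its three lines has as neighbourhood
  the part of \<open>P\<close> on its third line. At most \<open>p\<close> such parts are singletons, and at most \<open>a - d\<close>
  rows contain two or more cells of \<open>P\<close>, likewise for columns and symbols. Hence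
  \<open>ab + ac + bc - 3 \<le> p + (a - d) + (b - d) + (c - d)\<close>, which forces \<open>3d\<^sup>2 + d \<le> n + 3\<close>, that is
  \<open>(d + 1/6)\<^sup>2 \<le> n/3 + 37/36\<close>.
\<close>

section \<open>Counting fibres and grid cells, and the arithmetic of the bound\<close>

text \<open>Each nonempty fibre spends one element on its value, and a fibre of size at least two
  has another one left to spend on itself. This bounds the number of lines that contain several
  cells of \<open>P\<close>.\<close>

lemma card_fibres_ge2_add_card_image_le:
  assumes "finite P"
  shows "card {F. \<exists>y. F = {x\<in>P. f x = y} \<and> 2 \<le> card F} + card (f ` P) \<le> card P"
proof -
  let ?fib = "\<lambda>y. {x\<in>P. f x = y}"
  let ?B = "{y\<in>f ` P. 2 \<le> card (?fib y)}"
  have "{F. \<exists>y. F = ?fib y \<and> 2 \<le> card F} \<subseteq> ?fib ` ?B"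
  proof safe
    fix y assume y: "2 \<le> card (?fib y)"
    then have "?fib y \<noteq> {}" by (metis card.empty not_numeral_le_zero)
    with y show "?fib y \<in> ?fib ` ?B" by blast
  qed
  then have "card {F. \<exists>y. F = ?fib y \<and> 2 \<le> card F} \<le> card ?B"
    using assms by (intro surj_card_le) simp_all
  moreover have "card ?B + card (f ` P) = (\<Sum>y\<in>f ` P. (if 2 \<le> card (?fib y) then 1 else 0) + 1)"
    unfolding sum.distrib using assms by (simp add: sum.If_cases Int_def)
  moreover have "\<dots> \<le> (\<Sum>y\<in>f ` P. card (?fib y))"
  proof (rule sum_mono)
    fix y assume "y \<in> f ` P"
    then have "card (?fib y) > 0" using assms by (auto simp: card_gt_0_iff)
    then show "(if 2 \<le> card (?fib y) then 1 else 0) + 1 \<le> card (?fib y)" by auto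
  qed
  moreover have "\<dots> = card P"
    using sum.image_gen[OF assms, of "\<lambda>_. 1::nat" f] by simp
  ultimately show ?thesis by linarith
qed

lemma card_both_coordinates_missed:
  assumes bij: "bij_betw (\<lambda>v. (f v, g v)) V (A \<times> B)"
    and fin: "finite A" "finite B" and sub: "F \<subseteq> A" "G \<subseteq> B"
  shows "card {v\<in>V. f v \<notin> F \<and> g v \<notin> G} = (card A - card F) * (card B - card G)"
proof -
  let ?h = "\<lambda>v. (f v, g v)"
  have "?h ` {v\<in>V. f v \<notin> F \<and> g v \<notin> G} = {q \<in> ?h ` V. q \<in> (- F) \<times> (- G)}" by auto
  also have "\<dots> = (A - F) \<times> (B - G)" using bij by (auto simp: bij_betw_def)
  finally have "card ((A - F) \<times> (B - G)) = card {v\<in>V. f v \<notin> F \<and> g v \<notin> G}"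
    using card_image[OF inj_on_subset[OF bij_betw_imp_inj_on[OF bij]], of "{v\<in>V. f v \<notin> F \<and> g v \<notin> G}"]
    by auto
  then show ?thesis
    using fin sub by (simp add: card_Diff_subset finite_subset card_cartesian_product)
qed

lemma three_class_count:
  fixes n p a b c :: nat
  assumes "p < n" "n - p \<le> a" "n - p \<le> b" "n - p \<le> c"
    and count: "a * b + a * c + b * c + 3 * (n - p) \<le> p + a + b + c + 3"
  shows "3 * (n - p)^2 + (n - p) \<le> n + 3"
proof -
  define d where "d = n - p"
  obtain x y z where xyz: "a = d + x" "b = d + y" "c = d + z"
    using assms(2-4) unfolding d_def by (metis le_iff_add)
  have n: "n = p + d" and d: "d \<ge> 1" using assms(1) by (auto simp: d_def)
  \<comment> \<open>Expanding leaves the products \<open>x * y + x * z + y * z\<close>, which are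
    dropped. As \<open>d \<ge> 1\<close>, half of the mixed term then absorbs the excess
    \<open>x + y + z\<close> on the right of \<open>count\<close>.\<close>
  have "3 * d^2 + 2 * (d * (x + y + z)) \<le> a * b + a * c + b * c"
    by (simp add: xyz power2_eq_square algebra_simps)
  moreover have "x + y + z \<le> d * (x + y + z)" using d by simp
  moreover have "a * b + a * c + b * c \<le> p + (x + y + z) + 3"
    using count by (simp add: xyz flip: d_def)
  ultimately have "3 * d^2 + d \<le> n + 3" using n by linarith
  then show ?thesis by (simp add: d_def)
qed

section \<open>The counting bound for three symmetric classes of lines\<close>

text \<open>Here \<open>V\<close> is the set of cells and \<open>f\<close>, \<open>g\<close>, \<open>h\<close> give the row, the column and the symbol
  of a cell, so that the three play symmetric roles.\<close>

lemma locating_set_bound: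
  assumes "finite V" and fin: "finite A" "finite B" "finite C"
    and card: "card A = n" "card B = n" "card C = n"
    and fg: "bij_betw (\<lambda>v. (f v, g v)) V (A \<times> B)"
    and fh: "bij_betw (\<lambda>v. (f v, h v)) V (A \<times> C)"
    and gh: "bij_betw (\<lambda>v. (g v, h v)) V (B \<times> C)"
    and P: "P \<subseteq> V" "card P < n"
    and locating: "\<And>v w. v \<in> V - P \<Longrightarrow> w \<in> V - P \<Longrightarrow>
      {x\<in>P. f x = f v \<or> g x = g v \<or> h x = h v} = {x\<in>P. f x = f w \<or> g x = g w \<or> h x = h w} \<Longrightarrow>
      v = w"
  shows "3 * (n - card P)^2 + (n - card P) \<le> n + 3"
proof -
  define N where "N v = {x\<in>P. f x = f v \<or> g x = g v \<or> h x = h v}" for v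
  have inj: "inj_on N (V - P)"
    using locating unfolding N_def by (intro inj_onI)
  have finP: "finite P" using P(1) \<open>finite V\<close> finite_subset by blast
  have sub: "f ` P \<subseteq> A" "g ` P \<subseteq> B" "h ` P \<subseteq> C"
    using P(1) fg fh by (auto simp: bij_betw_def)
  define a b c where "a = n - card (f ` P)" and "b = n - card (g ` P)" and "c = n - card (h ` P)"
  have "card (f ` P) \<le> card P" "card (g ` P) \<le> card P" "card (h ` P) \<le> card P"
    using finP by (simp_all add: card_image_le)
  then have le: "n - card P \<le> a" "n - card P \<le> b" "n - card P \<le> c"
    unfolding a_def b_def c_def by simp_all

  define U where "U = {v\<in>V. f v \<notin> f ` P \<and> g v \<notin> g ` P \<and> h v \<notin> h ` P}"
  \<comment> \<open>The index names the only coordinate in which the cell shares a line with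
    \<open>P\<close>. Hence the three sets are disjoint, and they avoid \<open>P\<close>.\<close>
  define Tf where "Tf = {v\<in>V. g v \<notin> g ` P \<and> h v \<notin> h ` P} - U"
  define Tg where "Tg = {v\<in>V. f v \<notin> f ` P \<and> h v \<notin> h ` P} - U"
  define Th where "Th = {v\<in>V. f v \<notin> f ` P \<and> g v \<notin> g ` P} - U"
  note T_defs = Tf_def Tg_def Th_def U_def
  have finT: "finite U" "finite Tf" "finite Tg" "finite Th" using \<open>finite V\<close> by (auto simp: T_defs)
  have "v = w" if "v \<in> U" "w \<in> U" for v w
  proof (rule inj_onD[OF inj])
    have "N v = {}" "N w = {}" using that by (auto simp: N_def U_def image_iff)
    then show "N v = N w" by simp
    show "v \<in> V - P" "w \<in> V - P" using that by (auto simp: U_def)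
  qed
  then have U: "card U \<le> 1" using finT(1) by (simp add: card_le_Suc0_iff_eq)
  have cards: "card Tf + card U = b * c" "card Tg + card U = a * c" "card Th + card U = a * b"
  proof -
    have U_sub: "U \<subseteq> {v\<in>V. g v \<notin> g ` P \<and> h v \<notin> h ` P}"
      "U \<subseteq> {v\<in>V. f v \<notin> f ` P \<and> h v \<notin> h ` P}" "U \<subseteq> {v\<in>V. f v \<notin> f ` P \<and> g v \<notin> g ` P}"
      by (auto simp: U_def)
    have diff: "card (X - U) + card U = card X" if "U \<subseteq> X" "X \<subseteq> V" for X
      using that \<open>finite V\<close> by (metis card_Diff_subset card_mono finT(1) finite_subset le_add_diff_inverse2)
    show "card Tf + card U = b * c"
      using card_both_coordinates_missed[OF gh fin(2,3) sub(2,3)] diff[OF U_sub(1)] card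
      by (simp add: Tf_def b_def c_def)
    show "card Tg + card U = a * c"
      using card_both_coordinates_missed[OF fh fin(1,3) sub(1,3)] diff[OF U_sub(2)] card
      by (simp add: Tg_def a_def c_def)
    show "card Th + card U = a * b"
      using card_both_coordinates_missed[OF fg fin(1,2) sub(1,2)] diff[OF U_sub(3)] card
      by (simp add: Th_def a_def b_def)
  qed

  \<comment> \<open>Traces on \<open>P\<close> are counted as sets: a singleton counts once, in
    \<open>X\<close>, whichever class of lines it comes from, and only larger traces are counted
    class by class.\<close>
  define Bf where "Bf = {F. \<exists>y. F = {x\<in>P. f x = y} \<and> 2 \<le> card F}"
  define Bg where "Bg = {F. \<exists>y. F = {x\<in>P. g x = y} \<and> 2 \<le> card F}"
  define Bh where "Bh = {F. \<exists>y. F = {x\<in>P. h x = y} \<and> 2 \<le> card F}"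
  define X where "X = (\<lambda>x. {x}) ` P"
  have "X \<union> Bf \<union> Bg \<union> Bh \<subseteq> Pow P" by (auto simp: X_def Bf_def Bg_def Bh_def)
  then have finX: "finite (X \<union> Bf \<union> Bg \<union> Bh)" using finP by (meson finite_Pow_iff finite_subset)
  have Nf: "N v = {x\<in>P. f x = f v}" if "v \<in> Tf" for v
    using that by (auto simp: N_def T_defs image_iff)
  have Ng: "N v = {x\<in>P. g x = g v}" if "v \<in> Tg" for v
    using that by (auto simp: N_def T_defs image_iff)
  have Nh: "N v = {x\<in>P. h x = h v}" if "v \<in> Th" for v
    using that by (auto simp: N_def T_defs image_iff)
  have "N ` (Tf \<union> Tg \<union> Th) \<subseteq> X \<union> Bf \<union> Bg \<union> Bh"
  proof (rule image_subsetI)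
    fix v assume v: "v \<in> Tf \<union> Tg \<union> Th"
    show "N v \<in> X \<union> Bf \<union> Bg \<union> Bh"
    proof (cases "2 \<le> card (N v)")
      case True
      with v show ?thesis using Nf Ng Nh unfolding Bf_def Bg_def Bh_def by blast
    next
      case False
      have sub: "N v \<subseteq> P" by (auto simp: N_def)
      moreover have "N v \<noteq> {}" using v by (auto simp: N_def T_defs)
      ultimately have "card (N v) > 0" using finP by (simp add: card_gt_0_iff finite_subset)
      with False have "card (N v) = 1" by simp
      with sub show ?thesis by (auto simp: card_1_singleton_iff X_def)
    qed
  qed
  moreover have "Tf \<union> Tg \<union> Th \<subseteq> V - P" by (auto simp: T_defs)
  ultimately have "card (Tf \<union> Tg \<union> Th) \<le> card (X \<union> Bf \<union> Bg \<union> Bh)"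
    using inj finX by (meson card_inj_on_le inj_on_subset)
  also have "\<dots> \<le> card X + card Bf + card Bg + card Bh"
    by (meson add_le_mono1 card_Un_le le_trans)
  also have "card X = card P" by (simp add: X_def card_image)
  also have "card (Tf \<union> Tg \<union> Th) = card Tf + card Tg + card Th"
  proof -
    have "Tf \<inter> Tg = {}" "(Tf \<union> Tg) \<inter> Th = {}" by (auto simp: T_defs)
    then show ?thesis using finT by (simp add: card_Un_disjoint)
  qed
  finally have "card Tf + card Tg + card Th \<le> card P + card Bf + card Bg + card Bh" .
  \<comment> \<open>Since \<open>P\<close> meets \<open>n - a\<close> lines of the first class, the
    fibre count gives \<open>card Bf \<le> card P - (n - a)\<close>. The other two classes are
    alike.\<close>
  moreover have "card Bf + (n - card P) \<le> a"
    using card_fibres_ge2_add_card_image_le[OF finP, of f] P(2) unfolding Bf_def a_def by linarith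
  moreover have "card Bg + (n - card P) \<le> b"
    using card_fibres_ge2_add_card_image_le[OF finP, of g] P(2) unfolding Bg_def b_def by linarith
  moreover have "card Bh + (n - card P) \<le> c"
    using card_fibres_ge2_add_card_image_le[OF finP, of h] P(2) unfolding Bh_def c_def by linarith
  \<comment> \<open>Adding the equations \<open>cards\<close> counts \<open>U\<close> three times,
    whence the constant \<open>3\<close>.\<close>
  ultimately have "a * b + a * c + b * c + 3 * (n - card P) \<le> card P + a + b + c + 3"
    using cards U by linarith
  with P(2) le show ?thesis by (rule three_class_count)
qed

section \<open>Distances in the latin square graph\<close>

lemma (in wf_digraph) graph_dist_adjacent:
  assumes "u \<rightarrow> v" "u \<noteq> v"
  shows "graph_dist G u v = 1"
proof (rule antisym)
  obtain e where "arc e (u, v)" using assms(1) by (auto simp: arcs_ends_conv arc_def)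
  then have "awalk u [e] v" by (auto simp: arc_def awalk_Cons_iff awalk_Nil_iff)
  then have "graph_dist G u v \<le> ereal (real (length [e]))"
    unfolding graph_dist_eq_length by (intro INF_lower) simp
  then show "graph_dist G u v \<le> 1" by (simp add: one_ereal_def)
  show "1 \<le> graph_dist G u v"
    unfolding graph_dist_eq_length
  proof (rule INF_greatest)
    fix p assume "p \<in> {p. awalk u p v}"
    with assms(2) have "p \<noteq> []" by (auto simp: awalk_Nil_iff)
    then show "1 \<le> ereal (real (length p))" by (cases p) auto
  qed
qed

lemma (in wf_digraph) graph_dist_common_neighbour:
  assumes "u \<rightarrow> x" "x \<rightarrow> v" "\<not> u \<rightarrow> v" "u \<noteq> v"
  shows "graph_dist G u v = 2"
proof (rule antisym)
  obtain d e where "arc d (u, x)" "arc e (x, v)"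
    using assms(1,2) by (auto simp: arcs_ends_conv arc_def)
  then have "awalk u ([d] @ [e]) v"
    by (auto simp: arc_def awalk_Cons_iff awalk_Nil_iff)
  then have "graph_dist G u v \<le> ereal (real (length ([d] @ [e])))"
    unfolding graph_dist_eq_length by (intro INF_lower) simp
  then show "graph_dist G u v \<le> 2" by simp
  show "2 \<le> graph_dist G u v"
    unfolding graph_dist_eq_length
  proof (rule INF_greatest)
    fix p assume p: "p \<in> {p. awalk u p v}"
    have "p \<noteq> []" using assms(4) p by (auto simp: awalk_Nil_iff)
    moreover have "p \<noteq> [e]" for e
      using assms(3) p by (auto simp: awalk_Cons_iff awalk_Nil_iff intro: in_arcs_imp_in_arcs_ends)
    \<comment> \<open>The rule \<open>remdups_adj.cases\<close> serves only to split lists into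
      empty, singleton and longer ones.\<close>
    ultimately have "2 \<le> length p" by (cases p rule: remdups_adj.cases) auto
    then show "2 \<le> ereal (real (length p))" by simp
  qed
qed

lemma graph_dist_latin_square_graph:
  assumes u: "u \<in> {..<n} \<times> {..<n}" and v: "v \<in> {..<n} \<times> {..<n}" and "u \<noteq> v"
  shows "graph_dist (with_proj (latin_square_graph n L)) u v =
    (if fst u = fst v \<or> snd u = snd v \<or> case_prod L u = case_prod L v then 1 else 2)"
proof -
  let ?E = "parcs (latin_square_graph n L)"
  interpret pair_graph "latin_square_graph n L" by (rule pair_graph_latin_square_graph)
  have adj: "(x, y) \<in> ?E \<longleftrightarrow> fst x = fst y \<or> snd x = snd y \<or> case_prod L x = case_prod L y"
    if "x \<in> {..<n} \<times> {..<n}" "y \<in> {..<n} \<times> {..<n}" "x \<noteq> y" for x y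
    using that by (cases x, cases y) (simp add: latin_square_graph_def)
  show ?thesis
  proof (cases "(u, v) \<in> ?E")
    case True
    then show ?thesis using graph_dist_adjacent adj[OF assms] \<open>u \<noteq> v\<close> by simp
  next
    case False
    \<comment> \<open>The cell in the row of \<open>u\<close> and the column of \<open>v\<close>. It
      differs from both, because non-adjacent distinct cells share neither row nor column.\<close>
    let ?x = "(fst u, snd v)"
    have "(u, ?x) \<in> ?E" "(?x, v) \<in> ?E"
      using False adj[OF assms] u v by (subst adj; force)+
    then show ?thesis
      using graph_dist_common_neighbour[of u ?x v] False adj[OF assms] \<open>u \<noteq> v\<close> by simp
  qed
qed

section \<open>From latin squares to the counting bound\<close>

text \<open>This is the orthogonal array view: any two of row, column and symbol determine the cell,
  so the three classes of lines become interchangeable.\<close>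

lemma latin_square_bij_betw:
  assumes "latin_square n S L"
  shows "bij_betw (\<lambda>v. (fst v, case_prod L v)) ({..<n} \<times> {..<n}) ({..<n} \<times> S)"
    and "bij_betw (\<lambda>v. (snd v, case_prod L v)) ({..<n} \<times> {..<n}) ({..<n} \<times> S)"
proof -
  have mem: "\<And>i j. i < n \<Longrightarrow> j < n \<Longrightarrow> L i j \<in> S"
    and row: "\<And>i s. i < n \<Longrightarrow> s \<in> S \<Longrightarrow> \<exists>!j. j < n \<and> L i j = s"
    and col: "\<And>j s. j < n \<Longrightarrow> s \<in> S \<Longrightarrow> \<exists>!i. i < n \<and> L i j = s"
    using assms by (auto simp: latin_square_def)
  show "bij_betw (\<lambda>v. (fst v, case_prod L v)) ({..<n} \<times> {..<n}) ({..<n} \<times> S)"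
    unfolding bij_betw_def
  proof
    show "inj_on (\<lambda>v. (fst v, case_prod L v)) ({..<n} \<times> {..<n})"
      using row mem by (auto simp: inj_on_def)
    show "(\<lambda>v. (fst v, case_prod L v)) ` ({..<n} \<times> {..<n}) = {..<n} \<times> S"
      using row mem by (force simp: image_iff)
  qed
  show "bij_betw (\<lambda>v. (snd v, case_prod L v)) ({..<n} \<times> {..<n}) ({..<n} \<times> S)"
    unfolding bij_betw_def
  proof
    show "inj_on (\<lambda>v. (snd v, case_prod L v)) ({..<n} \<times> {..<n})"
      using col mem by (auto simp: inj_on_def)
    show "(\<lambda>v. (snd v, case_prod L v)) ` ({..<n} \<times> {..<n}) = {..<n} \<times> S"
      using col mem by (force simp: image_iff)
  qed
qed

text \<open>Seen from a cell of \<open>us\<close>, a cell outside \<open>us\<close> is at distance 1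
  or 2 according to whether they share a line. So equal traces on \<open>us\<close> mean equal
  distance vectors, and a resolving list is locating.\<close>

lemma resolving_latin_square_graph_bound:
  assumes L: "latin_square n S L"
    and us: "resolving (with_proj (latin_square_graph n L)) us"
    and less: "card (set us) < n"
  shows "3 * (n - card (set us))^2 + (n - card (set us)) \<le> n + 3"
proof (rule locating_set_bound[where f = fst and g = snd and h = "case_prod L"
      and V = "{..<n} \<times> {..<n}" and A = "{..<n}" and B = "{..<n}" and C = S])
  let ?V = "{..<n} \<times> {..<n}"
  show "finite S" "card S = n" using L by (auto simp: latin_square_def)
  have sub: "set us \<subseteq> ?V"
    using us by (simp add: resolving_def latin_square_graph_def)
  then show "set us \<subseteq> ?V" .
  fix v w
  assume v: "v \<in> ?V - set us" and w: "w \<in> ?V - set us"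
    and eq: "{x\<in>set us. fst x = fst v \<or> snd x = snd v \<or> case_prod L x = case_prod L v} =
      {x\<in>set us. fst x = fst w \<or> snd x = snd w \<or> case_prod L x = case_prod L w}"
  have "graph_dist (with_proj (latin_square_graph n L)) u v =
      graph_dist (with_proj (latin_square_graph n L)) u w" if u: "u \<in> set us" for u
  proof -
    have "fst u = fst v \<or> snd u = snd v \<or> case_prod L u = case_prod L v \<longleftrightarrow>
        fst u = fst w \<or> snd u = snd w \<or> case_prod L u = case_prod L w"
      using eq u by blast
    moreover have "u \<in> ?V" "v \<in> ?V" "w \<in> ?V" "u \<noteq> v" "u \<noteq> w" using u v w sub by auto
    ultimately show ?thesis by (simp only: graph_dist_latin_square_graph not_False_eq_True)
  qed
  moreover have "v \<in> verts (with_proj (latin_square_graph n L))"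
    "w \<in> verts (with_proj (latin_square_graph n L))"
    using v w by (auto simp: latin_square_graph_def)
  ultimately show "v = w" using us by (simp add: resolving_def)
qed (use L less latin_square_bij_betw[OF L] in \<open>auto simp: bij_betw_def\<close>)

theorem theorem3p5:
  fixes n :: nat and S :: "'s set" and L :: "nat \<Rightarrow> nat \<Rightarrow> 's"
  assumes "n > 0"
    and "latin_square n S L"
  shows "real (metric_dimension (with_proj (latin_square_graph n L)))
           \<ge> real n - sqrt (real n / 3 + 37 / 36) + 1 / 6"
proof -
  let ?G = "with_proj (latin_square_graph n L)"
  interpret pair_graph "latin_square_graph n L" by (rule pair_graph_latin_square_graph)
  have "\<exists>m us. length us = m \<and> resolving ?G us" using resolving_exists by blast
  then have "\<exists>us. length us = metric_dimension ?G \<and> resolving ?G us"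
    unfolding metric_dimension_def by (rule LeastI_ex)
  then obtain us where us: "length us = metric_dimension ?G" "resolving ?G us" by blast
  \<comment> \<open>The list may repeat vertices, so its length only bounds \<open>p\<close> from
    above; this is the direction needed.\<close>
  define p where "p = card (set us)"
  have p: "p \<le> metric_dimension ?G" using card_length[of us] us(1) by (simp add: p_def)
  have "real n - real p + 1 / 6 \<le> sqrt (real n / 3 + 37 / 36)"
  proof (cases "p < n")
    case True
    define d where "d = n - p"
    have "3 * d^2 + d \<le> n + 3"
      using resolving_latin_square_graph_bound[OF assms(2) us(2)] True by (simp add: d_def p_def)
    then have "3 * (real d)\<^sup>2 + real d \<le> real n + 3"
      by (metis (mono_tags, lifting) of_nat_add of_nat_le_iff of_nat_mult of_nat_numeral of_nat_power)
    \<comment> \<open>Divide by 3 and complete the square: the constant is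
      \<open>1 + 1 / 36\<close>.\<close>
    then have "(real d + 1 / 6)\<^sup>2 \<le> real n / 3 + 37 / 36"
      by (simp add: power2_eq_square field_simps)
    then have "real d + 1 / 6 \<le> sqrt (real n / 3 + 37 / 36)" by (rule real_le_rsqrt)
    then show ?thesis using True by (simp add: d_def of_nat_diff)
  next
    case False
    \<comment> \<open>For \<open>p \<ge> n\<close> the left side of the goal is at most
      \<open>1 / 6\<close>.\<close>
    moreover have "1 / 6 \<le> sqrt (real n / 3 + 37 / 36)"
      by (rule real_le_rsqrt) (simp add: power2_eq_square)
    ultimately show ?thesis by simp
  qed
  with p show ?thesis by linarith
qed

end
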